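(* Let $n\in\mathbb{N}$. Then $$\sum_{\sigma\in B_n}x^{\mathrm{nstc}(\sigma)}q^{\ell(\sigma)}=\sum_{\sigma\in B_n}x^{\mathrm{ndes}(\sigma)}q^{\mathrm{nmaj}(\sigma)}.$$
   Context: $[n]=\{1,\ldots,n\}$. The hyperoctahedral group $B_n$ is the group of signed permutations: bijections $\sigma$ of $\{\pm1,\ldots,\pm n\}$ with $\sigma(-i)=-\sigma(i)$, written $\sigma=\sigma_1\cdots\sigma_n$ with $\sigma_i=\sigma(i)$, so that $|\sigma_1|\cdots|\sigma_n|\in S_n$. For $\sigma\in B_n$: $\mathrm{Neg}(\sigma)=\{i\in[n] : \sigma(i)<0\}$, $\mathrm{neg}(\sigma)=|\mathrm{Neg}(\sigma)|$; $\mathrm{Des}(\sigma)=\{i\in[n-1] : \sigma(i)>\sigma(i+1)\}$, $\mathrm{des}(\sigma)=|\mathrm{Des}(\sigma)|$, $\mathrm{maj}(\sigma)=\sum_{i\in\mathrm{Des}(\sigma)}i$; $\mathrm{inv}(\sigma)=|\{(i,j)\in[n]\times[n] : i<j,\ \sigma(i)>\sigma(j)\}|$; $\mathrm{nsp}(\sigma)=|\{(i,j)\in[n]\times[n] : i<j,\ \sigma(i)+\sigma(j)<0\}|$. The Coxeter length on $B_n$ is $\ell(\sigma)=\mathrm{inv}(\sigma)+\mathrm{neg}(\sigma)+\mathrm{nsp}(\sigma)=\mathrm{inv}(\sigma)-\sum_{i\in\mathrm{Neg}(\sigma)}\sigma(i)$. Negative descent number and negative major index: $\mathrm{ndes}(\sigma)=\mathrm{des}(\sigma)+\mathrm{neg}(\sigma)$,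 $\mathrm{nmaj}(\sigma)=\mathrm{maj}(\sigma)-\sum_{i\in\mathrm{Neg}(\sigma)}\sigma(i)$. The statistic stc: for $\sigma\in B_n$ (using the usual order on integers), $\mathrm{code}(\sigma)=c_1\cdots c_n$ with $c_i=|\{j : i<j\le n,\ \sigma(i)>\sigma(j)\}|$. For a word $w=w_1\cdots w_n$ of nonnegative integers with $w_i\le n-i$, $\mathrm{st}(w)$ is the largest $r\in[n]$ for which there exist indices $i_1<\cdots<i_r$ such that $w_{i_j}>r-j$ for all $j=1,\ldots,r$; $\mathrm{st}(w)=0$ if no such $r$ exists. Then $\mathrm{stc}(\sigma):=\mathrm{st}(\mathrm{code}(\sigma))$. Finally, $\mathrm{nstc}(\sigma):=\mathrm{stc}(\sigma)+\mathrm{neg}(\sigma)$. *)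

theory Defs
  imports "HOL-Combinatorics.Permutations"
begin

text \<open>
  A signed permutation is represented as a function on all integers that is the identity outside
  \<open>{\<plusminus>1, \<dots>, \<plusminus>n}\<close> (this is part of \<^const>\<open>permutes\<close>), so that every signed permutation has
  exactly one representative.  Positions are natural numbers in \<open>{1..n}\<close>, and the letter
  \<open>\<sigma>\<^sub>i\<close> of the word of \<open>\<sigma>\<close> is \<open>\<sigma> (int i)\<close>.
\<close>

definition hyperoctahedral :: "nat \<Rightarrow> (int \<Rightarrow> int) set" where
  "hyperoctahedral n =
     {\<sigma>. \<sigma> permutes ({- int n..int n} - {0}) \<and> (\<forall>i \<in> {- int n..int n} - {0}. \<sigma> (- i) = - \<sigma> i)}"

lemma finite_hyperoctahedral: "finite (hyperoctahedral n)"
  by (rule finite_subset[OF _ finite_permutations[of "{- int n..int n} - {0}"]])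
    (auto simp: hyperoctahedral_def)

definition Neg :: "nat \<Rightarrow> (int \<Rightarrow> int) \<Rightarrow> nat set" where
  "Neg n \<sigma> = {i \<in> {1..n}. \<sigma> (int i) < 0}"

definition neg :: "nat \<Rightarrow> (int \<Rightarrow> int) \<Rightarrow> nat" where
  "neg n \<sigma> = card (Neg n \<sigma>)"

definition Des :: "nat \<Rightarrow> (int \<Rightarrow> int) \<Rightarrow> nat set" where
  "Des n \<sigma> = {i \<in> {1..<n}. \<sigma> (int i) > \<sigma> (int (i + 1))}"

definition des :: "nat \<Rightarrow> (int \<Rightarrow> int) \<Rightarrow> nat" where
  "des n \<sigma> = card (Des n \<sigma>)"

definition maj :: "nat \<Rightarrow> (int \<Rightarrow> int) \<Rightarrow> nat" where
  "maj n \<sigma> = \<Sum> (Des n \<sigma>)"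

definition inversion_number :: "nat \<Rightarrow> (int \<Rightarrow> int) \<Rightarrow> nat" where
  "inversion_number n \<sigma> =
     card {(i, j). (i, j) \<in> {1..n} \<times> {1..n} \<and> i < j \<and> \<sigma> (int i) > \<sigma> (int j)}"

definition nsp :: "nat \<Rightarrow> (int \<Rightarrow> int) \<Rightarrow> nat" where
  "nsp n \<sigma> = card {(i, j). (i, j) \<in> {1..n} \<times> {1..n} \<and> i < j \<and> \<sigma> (int i) + \<sigma> (int j) < 0}"

definition coxeter_length :: "nat \<Rightarrow> (int \<Rightarrow> int) \<Rightarrow> nat" where
  "coxeter_length n \<sigma> = inversion_number n \<sigma> + neg n \<sigma> + nsp n \<sigma>"

definition ndes :: "nat \<Rightarrow> (int \<Rightarrow> int) \<Rightarrow> nat" where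
  "ndes n \<sigma> = des n \<sigma> + neg n \<sigma>"

definition nmaj :: "nat \<Rightarrow> (int \<Rightarrow> int) \<Rightarrow> nat" where
  "nmaj n \<sigma> = nat (int (maj n \<sigma>) - (\<Sum>i \<in> Neg n \<sigma>. \<sigma> (int i)))"

text \<open>The conversion to natural numbers in \<open>nmaj\<close> loses no information.\<close>

lemma int_nmaj: "int (nmaj n \<sigma>) = int (maj n \<sigma>) - (\<Sum>i \<in> Neg n \<sigma>. \<sigma> (int i))"
proof -
  have "(\<Sum>i \<in> Neg n \<sigma>. \<sigma> (int i)) \<le> 0"
    by (rule sum_nonpos) (auto simp: Neg_def)
  then show ?thesis
    by (simp add: nmaj_def)
qed

definition lehmer_code :: "nat \<Rightarrow> (int \<Rightarrow> int) \<Rightarrow> nat \<Rightarrow> nat" where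
  "lehmer_code n \<sigma> i = card {j. i < j \<and> j \<le> n \<and> \<sigma> (int i) > \<sigma> (int j)}"

text \<open>
  A word \<open>w\<^sub>1\<cdots>w\<^sub>n\<close> is a function of which only the values on \<open>{1..n}\<close> matter.  The increasing
  indices \<open>i\<^sub>1 < \<cdots> < i\<^sub>r\<close> are the values of \<open>f\<close> on \<open>{1..r}\<close>.
\<close>

definition st :: "nat \<Rightarrow> (nat \<Rightarrow> nat) \<Rightarrow> nat" where
  "st n w = Max (insert 0 {r \<in> {1..n}. \<exists>f :: nat \<Rightarrow> nat.
     strict_mono_on {1..r} f \<and> f ` {1..r} \<subseteq> {1..n} \<and> (\<forall>j \<in> {1..r}. w (f j) > r - j)})"

definition stc :: "nat \<Rightarrow> (int \<Rightarrow> int) \<Rightarrow> nat" where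
  "stc n \<sigma> = st n (lehmer_code n \<sigma>)"

definition nstc :: "nat \<Rightarrow> (int \<Rightarrow> int) \<Rightarrow> nat" where
  "nstc n \<sigma> = stc n \<sigma> + neg n \<sigma>"

end

theory Submission
  imports Defs "HOL-Combinatorics.Multiset_Permutations"
begin

text \<open>
  A signed permutation is determined by the set \<open>A\<close> of its letters \<open>\<sigma>\<^sub>1, \<dots>, \<sigma>\<^sub>n\<close>, which records
  the signs, and by the order in which these letters are written.  The number of negative letters
  and the sum of their absolute values depend on \<open>A\<close> alone.  After the identity
  \<open>neg + nsp = -(sum of the negative letters)\<close> (lemma \<open>neg_add_nsp\<close>), both sides of the theorem are
  therefore sums over \<open>A\<close> in which each \<open>A\<close> contributes a fixed monomial times the generating
  function, over all orderings of \<open>A\<close>, of \<open>(stc, inv)\<close> on the left and of \<open>(des, maj)\<close> on the right.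

  It remains to see that these two pairs are equidistributed on the orderings of any \<open>n\<close>-element
  set.  Both grow by the same rule.  From a word of size \<open>n\<close> with statistics \<open>(s, k)\<close> one obtains
  \<open>n + 1\<close> words of size \<open>n + 1\<close>, one for each \<open>a \<le> n\<close>, with statistics \<open>(s, k + a)\<close> if \<open>a \<le> s\<close>, and
  \<open>(s + 1, k + a)\<close> otherwise:

  \<^item> for \<open>(stc, inv)\<close>, put a new letter in front of the word; \<open>a\<close> is its Lehmer code entry, that is,
    the number of smaller letters after it (\<open>sum_stc_inv\<close>, \<open>st_Suc\<close>);
  \<^item> for \<open>(des, maj)\<close>, insert a new largest letter in one of the \<open>n + 1\<close> gaps; \<open>a\<close> is the increase
    of the major index, which takes every value in \<open>{0..n}\<close> once and leaves the number of descents
    unchanged precisely for the values that are at most that number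
    (\<open>sum_des_maj\<close>, \<open>bij_betw_maj_gain\<close>, \<open>maj_gain_le_iff\<close>).
\<close>

section \<open>One recursion for two pairs of statistics\<close>

text \<open>
  The sum of \<open>g s k\<close> over the multiset of pairs \<open>(s, k)\<close> generated from \<open>(0, 0)\<close> by the growth rule.
  Since \<open>g\<close> is an arbitrary function, the last growth step can be absorbed into it, and the
  recursion descends on the size alone.
\<close>

primrec eulerian_step_sum :: "nat \<Rightarrow> (nat \<Rightarrow> nat \<Rightarrow> 'a :: comm_monoid_add) \<Rightarrow> 'a" where
  "eulerian_step_sum 0 g = g 0 0"
| "eulerian_step_sum (Suc n) g =
     eulerian_step_sum n (\<lambda>s k. \<Sum>a\<le>n. g (if a \<le> s then s else Suc s) (k + a))"

lemma eulerian_step_sum_sum: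
  "eulerian_step_sum n (\<lambda>s k. \<Sum>i\<in>I. g i s k) = (\<Sum>i\<in>I. eulerian_step_sum n (g i))"
proof (induction n arbitrary: g)
  case (Suc n)
  have "(\<Sum>a\<le>n. \<Sum>i\<in>I. g i (if a \<le> s then s else Suc s) (k + a))
      = (\<Sum>i\<in>I. \<Sum>a\<le>n. g i (if a \<le> s then s else Suc s) (k + a))" for s k
    by (rule sum.swap)
  then show ?case
    by (simp add: Suc.IH)
qed simp

section \<open>Code and inversions\<close>

text \<open>
  Recursion on the first letter, as dictated by the way \<open>st\<close> reacts to a new first entry of a code
  (\<open>st_Suc\<close>).
\<close>

primrec word_stc :: "int list \<Rightarrow> nat" where
  "word_stc [] = 0"
| "word_stc (a # ys) =
     (if length (filter (\<lambda>y. y < a) ys) \<le> word_stc ys then word_stc ys else Suc (word_stc ys))"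

primrec word_inv :: "int list \<Rightarrow> nat" where
  "word_inv [] = 0"
| "word_inv (a # ys) = word_inv ys + length (filter (\<lambda>y. y < a) ys)"

lemma bij_betw_rank:
  fixes A :: "int set"
  assumes "finite A"
  shows "bij_betw (\<lambda>a. card {y \<in> A. y < a}) A {..<card A}"
proof -
  have mono: "card {y \<in> A. y < a} < card {y \<in> A. y < b}" if "a \<in> A" "a < b" for a b
    using that assms by (intro psubset_card_mono) auto
  have inj: "inj_on (\<lambda>a. card {y \<in> A. y < a}) A"
  proof (rule inj_onI)
    fix a b assume "a \<in> A" "b \<in> A" "card {y \<in> A. y < a} = card {y \<in> A. y < b}"
    with mono[of a b] mono[of b a] show "a = b" by (cases a b rule: linorder_cases) auto
  qed
  have "card {y \<in> A. y < a} < card A" if "a \<in> A" for a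
    using that assms by (intro psubset_card_mono) auto
  with inj have "(\<lambda>a. card {y \<in> A. y < a}) ` A = {..<card A}"
    by (intro card_subset_eq) (auto simp: card_image)
  with inj show ?thesis by (simp add: bij_betw_def)
qed

text \<open>
  Split the orderings of \<open>A\<close> by their first letter \<open>a\<close>.  Its code entry is the rank of \<open>a\<close> in \<open>A\<close>,
  whatever the order of the remaining letters, and the ranks run through \<open>{0..n}\<close> as \<open>a\<close> runs
  through \<open>A\<close>.
\<close>

lemma sum_stc_inv:
  assumes "finite A" "card A = n"
  shows "(\<Sum>xs\<in>permutations_of_set A. g (word_stc xs) (word_inv xs)) = eulerian_step_sum n g"
  using assms
proof (induction n arbitrary: A g)
  case (Suc n)
  let ?h = "\<lambda>r s k. g (if r \<le> s then s else Suc s) (k + r)"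
  let ?r = "\<lambda>a. card {y \<in> A. y < a}"
  have ne: "A \<noteq> {}" using Suc.prems by auto
  have len: "length (filter (\<lambda>y. y < a) ys) = ?r a"
    if "a \<in> A" "ys \<in> permutations_of_set (A - {a})" for a ys
  proof -
    have "length (filter (\<lambda>y. y < a) ys) = card (set (filter (\<lambda>y. y < a) ys))"
      using that by (intro distinct_card[symmetric]) (auto simp: permutations_of_set_def)
    also have "set (filter (\<lambda>y. y < a) ys) = {y \<in> A. y < a}"
      using that by (auto simp: permutations_of_set_def)
    finally show ?thesis .
  qed
  have "(\<Sum>xs\<in>permutations_of_set A. g (word_stc xs) (word_inv xs))
      = (\<Sum>a\<in>A. \<Sum>xs\<in>(#) a ` permutations_of_set (A - {a}). g (word_stc xs) (word_inv xs))"
    unfolding permutations_of_set_nonempty[OF ne]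
    by (rule sum.UNION_disjoint) (use Suc.prems in auto)
  also have "\<dots> = (\<Sum>a\<in>A. \<Sum>ys\<in>permutations_of_set (A - {a}). ?h (?r a) (word_stc ys) (word_inv ys))"
  proof (rule sum.cong[OF refl])
    fix a assume a: "a \<in> A"
    have "(\<Sum>xs\<in>(#) a ` permutations_of_set (A - {a}). g (word_stc xs) (word_inv xs))
        = (\<Sum>ys\<in>permutations_of_set (A - {a}). g (word_stc (a # ys)) (word_inv (a # ys)))"
      by (subst sum.reindex) (auto simp: o_def)
    also have "\<dots> = (\<Sum>ys\<in>permutations_of_set (A - {a}). ?h (?r a) (word_stc ys) (word_inv ys))"
      by (rule sum.cong[OF refl]) (simp add: len[OF a])
    finally show "(\<Sum>xs\<in>(#) a ` permutations_of_set (A - {a}). g (word_stc xs) (word_inv xs)) = \<dots>" .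
  qed
  also have "\<dots> = (\<Sum>a\<in>A. eulerian_step_sum n (?h (?r a)))"
    using Suc.prems by (intro sum.cong[OF refl] Suc.IH) auto
  also have "\<dots> = (\<Sum>r\<in>{..<card A}. eulerian_step_sum n (?h r))"
    by (rule sum.reindex_bij_betw[OF bij_betw_rank[OF Suc.prems(1)]])
  also have "\<dots> = eulerian_step_sum (Suc n) g"
    using Suc.prems by (simp add: eulerian_step_sum_sum lessThan_Suc_atMost)
  finally show ?case .
qed simp

section \<open>Descents and major index\<close>

definition word_Des :: "int list \<Rightarrow> nat set" where
  "word_Des xs = {i \<in> {1..<length xs}. xs ! (i - 1) > xs ! i}"

definition insert_at :: "nat \<Rightarrow> 'a \<Rightarrow> 'a list \<Rightarrow> 'a list" where
  "insert_at p m ys = take p ys @ m # drop p ys"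

text \<open>
  The increase of the major index when a new largest letter is inserted after \<open>p\<close> letters of a word
  of length \<open>n\<close> with descent set \<open>D\<close>.  At a descent \<open>p\<close>, this descent and all later ones move by one.
  At any other \<open>p < n\<close> a new descent \<open>p + 1\<close> appears and the later ones move by one.  At the end of
  the word, \<open>p = n\<close>, nothing happens.
\<close>

definition maj_gain :: "nat set \<Rightarrow> nat \<Rightarrow> nat \<Rightarrow> nat" where
  "maj_gain D n p =
     (if p \<in> insert n D then card {d \<in> D. p \<le> d} else Suc p + card {d \<in> D. p < d})"

lemma finite_word_Des [simp]: "finite (word_Des xs)"
  by (simp add: word_Des_def)

text \<open>
  If \<open>p\<close> is neither a descent nor the end, then each descent is either among the \<open>p\<close> numbers below
  \<open>p\<close> or above \<open>p\<close>, so that the gain \<open>p + 1 + |{d \<in> D. p < d}|\<close> exceeds \<open>|D|\<close>.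
\<close>

lemma maj_gain_le_iff:
  assumes D: "D \<subseteq> {1..<n}" and p: "p \<le> n"
  shows "maj_gain D n p \<le> card D \<longleftrightarrow> p \<in> insert n D"
proof (cases "p \<in> insert n D")
  case True
  have "finite D" using D by (rule finite_subset) simp
  then have "card {d \<in> D. p \<le> d} \<le> card D"
    by (intro card_mono) auto
  then show ?thesis using True by (simp add: maj_gain_def)
next
  case False
  have fin: "finite D" using D by (rule finite_subset) simp
  have "D \<subseteq> {..<p} \<union> {d \<in> D. p < d}"
    using False by (auto simp: not_less_iff_gr_or_eq)
  then have "card D \<le> card ({..<p} \<union> {d \<in> D. p < d})"
    using fin by (intro card_mono) auto
  also have "\<dots> \<le> p + card {d \<in> D. p < d}"
    using card_Un_le[of "{..<p}" "{d \<in> D. p < d}"] by simp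
  finally show ?thesis using False by (simp add: maj_gain_def)
qed

text \<open>
  The gain strictly decreases along the positions in \<open>D \<union> {n}\<close>, and strictly increases along the
  others, because at most \<open>p' - p - 1\<close> descents lie strictly between \<open>p\<close> and \<open>p'\<close>.  By
  \<open>maj_gain_le_iff\<close> the two kinds of positions have gains in disjoint ranges, so the gain is
  injective, and it maps \<open>{0..n}\<close> to itself.
\<close>

lemma bij_betw_maj_gain:
  assumes D: "D \<subseteq> {1..<n}"
  shows "bij_betw (maj_gain D n) {..n} {..n}"
proof -
  have fin: "finite D" using D by (rule finite_subset) simp
  have le: "maj_gain D n p \<le> n" if p: "p \<le> n" for p
  proof (cases "p \<in> insert n D")
    case True
    then have "maj_gain D n p \<le> card D" using maj_gain_le_iff[OF D p] by simp
    also have "\<dots> \<le> n" using card_mono[OF _ D] by simp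
    finally show ?thesis .
  next
    case False
    have "{d \<in> D. p < d} \<subseteq> {Suc p..<n}" using D by auto
    then have "card {d \<in> D. p < d} \<le> n - Suc p" using card_mono[of "{Suc p..<n}"] by simp
    then show ?thesis using False p by (auto simp: maj_gain_def)
  qed
  have neq: "maj_gain D n p \<noteq> maj_gain D n p'" if pp: "p < p'" "p' \<le> n" for p p'
  proof (cases "p \<in> insert n D \<longleftrightarrow> p' \<in> insert n D")
    case False
    then show ?thesis using maj_gain_le_iff[OF D, of p] maj_gain_le_iff[OF D, of p'] pp by auto
  next
    case True
    show ?thesis
    proof (cases "p \<in> insert n D")
      case T: True
      then have "p \<in> {d \<in> D. p \<le> d} - {d \<in> D. p' \<le> d}"
        using pp by auto
      moreover have "{d \<in> D. p' \<le> d} \<subseteq> {d \<in> D. p \<le> d}"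
        using pp by auto
      ultimately have "{d \<in> D. p' \<le> d} \<subset> {d \<in> D. p \<le> d}"
        by blast
      then have "card {d \<in> D. p' \<le> d} < card {d \<in> D. p \<le> d}"
        using fin by (intro psubset_card_mono) auto
      then show ?thesis using T True by (simp add: maj_gain_def)
    next
      case F: False
      have "{d \<in> D. p < d} \<subseteq> {Suc p..<p'} \<union> {d \<in> D. p' < d}"
        using F True by (auto simp: not_less_iff_gr_or_eq)
      then have "card {d \<in> D. p < d} \<le> card ({Suc p..<p'} \<union> {d \<in> D. p' < d})"
        using fin by (intro card_mono) auto
      also have "\<dots> \<le> (p' - Suc p) + card {d \<in> D. p' < d}"
        using card_Un_le[of "{Suc p..<p'}" "{d \<in> D. p' < d}"] by simp
      finally show ?thesis using F True pp by (simp add: maj_gain_def)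
    qed
  qed
  have inj: "inj_on (maj_gain D n) {..n}"
  proof (rule inj_onI)
    fix p p' assume "p \<in> {..n}" "p' \<in> {..n}" "maj_gain D n p = maj_gain D n p'"
    then show "p = p'" using neq[of p p'] neq[of p' p] by (cases p p' rule: linorder_cases) auto
  qed
  have "maj_gain D n ` {..n} = {..n}"
    using le inj by (intro endo_inj_surj) auto
  with inj show ?thesis by (simp add: bij_betw_def)
qed

lemma word_Des_insert_at:
  assumes m: "\<And>y. y \<in> set ys \<Longrightarrow> y < m" and p: "p < length ys"
  shows "word_Des (insert_at p m ys) =
     insert (Suc p) ({d \<in> word_Des ys. d < p} \<union> Suc ` {d \<in> word_Des ys. p < d})"
    (is "?L = ?R")
proof -
  have nth: "insert_at p m ys ! i =
      (if i < p then ys ! i else if i = p then m else ys ! (i - 1))" for i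
    using p by (auto simp: insert_at_def nth_append nth_Cons split: nat.splits
        intro!: arg_cong[of _ _ "(!) ys"])
  have len: "length (insert_at p m ys) = Suc (length ys)"
    using p by (simp add: insert_at_def)
  have lt: "ys ! i < m" if "i < length ys" for i
    using that m by simp
  show ?thesis
  proof (rule set_eqI)
    fix i
    consider "i = 0" | "0 < i" "i < p" | "0 < i" "i = p" | "i = Suc p" | d where "i = Suc d" "p < d"
      by (metis Suc_lessE not_gr_zero not_less_iff_gr_or_eq less_antisym)
    then show "i \<in> ?L \<longleftrightarrow> i \<in> ?R"
    proof cases
      case 3
      then have "ys ! (p - 1) < m" using p by (intro lt) linarith
      with 3 show ?thesis using p by (auto simp: word_Des_def nth len)
    next
      case 4
      then show ?thesis using p lt[of p] by (auto simp: word_Des_def nth len)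
    qed (use p in \<open>auto simp: word_Des_def nth len\<close>)
  qed
qed

lemma sum_Suc_image: "\<Sum> (Suc ` B) = \<Sum> B + card B" if "finite B"
  using that by (subst sum.reindex) (auto simp: sum_Suc)

lemma des_maj_insert_at:
  assumes m: "\<And>y. y \<in> set ys \<Longrightarrow> y < m" and p: "p \<le> length ys"
  defines "D \<equiv> word_Des ys" and "a \<equiv> maj_gain (word_Des ys) (length ys) p"
  shows "card (word_Des (insert_at p m ys)) = (if a \<le> card D then card D else Suc (card D))"
    and "\<Sum> (word_Des (insert_at p m ys)) = \<Sum> D + a"
proof -
  let ?n = "length ys"
  have D: "D \<subseteq> {1..<?n}" by (auto simp: D_def word_Des_def)
  have fin: "finite D" by (simp add: D_def)
  have a: "a \<le> card D \<longleftrightarrow> p \<in> insert ?n D"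
    using maj_gain_le_iff[OF D p] by (simp add: a_def D_def)
  (* Descents before p survive, those after p move by one; only p itself needs a case distinction. *)
  let ?L = "{d \<in> D. d < p}" and ?G = "{d \<in> D. p < d}"
  have split: "D = (if p \<in> D then insert p (?L \<union> ?G) else ?L \<union> ?G)"
    by (auto simp: not_less_iff_gr_or_eq)
  have LG: "card (?L \<union> ?G) = card ?L + card ?G" "\<Sum> (?L \<union> ?G) = \<Sum> ?L + \<Sum> ?G"
    using fin by (auto intro!: card_Un_disjoint sum.union_disjoint)
  have cD: "card D = card ?L + card ?G + (if p \<in> D then 1 else 0)"
    using LG(1) fin by (subst split) (auto simp: card_insert_if)
  have sD: "\<Sum> D = \<Sum> ?L + \<Sum> ?G + (if p \<in> D then p else 0)"
    using LG(2) fin by (subst split) auto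
  have goal: "card (word_Des (insert_at p m ys)) = (if a \<le> card D then card D else Suc (card D))
      \<and> \<Sum> (word_Des (insert_at p m ys)) = \<Sum> D + a"
  proof (cases "p = ?n")
    case True
    have "word_Des (insert_at p m ys) = D"
      unfolding D_def
    proof (rule set_eqI)
      fix i show "i \<in> word_Des (insert_at p m ys) \<longleftrightarrow> i \<in> word_Des ys"
        using True m[of "ys ! (i - 1)"]
        by (cases "i = ?n") (auto simp: word_Des_def insert_at_def nth_append)
    qed
    moreover have "a = 0"
      using D fin True by (auto simp: a_def maj_gain_def D_def)
    ultimately show ?thesis by simp
  next
    case False
    with p have p': "p < ?n" by simp
    have W: "word_Des (insert_at p m ys) = insert (Suc p) (?L \<union> Suc ` ?G)"
      using word_Des_insert_at[OF m p'] by (simp add: D_def)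
    have disj: "?L \<inter> Suc ` ?G = {}" and ni: "Suc p \<notin> ?L \<union> Suc ` ?G" by auto
    have finLG: "finite ?L" "finite (Suc ` ?G)" "finite ?G" using fin by auto
    have c: "card (word_Des (insert_at p m ys)) = Suc (card ?L + card ?G)"
      using W ni finLG card_Un_disjoint[OF finLG(1,2) disj] by (simp add: card_image)
    have s: "\<Sum> (word_Des (insert_at p m ys)) = Suc p + (\<Sum> ?L + (\<Sum> ?G + card ?G))"
    proof -
      have "\<Sum> (word_Des (insert_at p m ys)) = Suc p + \<Sum> (?L \<union> Suc ` ?G)"
        unfolding W by (rule sum.insert) (use finLG ni in auto)
      also have "\<Sum> (?L \<union> Suc ` ?G) = \<Sum> ?L + \<Sum> (Suc ` ?G)"
        by (rule sum.union_disjoint) (use finLG disj in auto)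
      finally show ?thesis using sum_Suc_image[OF finLG(3)] by simp
    qed
    have a_val: "a = (if p \<in> D then Suc (card ?G) else Suc p + card ?G)"
    proof (cases "p \<in> D")
      case True
      then have "{d \<in> D. p \<le> d} = insert p ?G" by auto
      then show ?thesis using True finLG by (simp add: a_def maj_gain_def D_def[symmetric])
    qed (use False in \<open>simp add: a_def maj_gain_def D_def[symmetric]\<close>)
    show ?thesis
      using a c s cD sD a_val False by (cases "p \<in> D") auto
  qed
  then show "card (word_Des (insert_at p m ys)) = (if a \<le> card D then card D else Suc (card D))"
    and "\<Sum> (word_Des (insert_at p m ys)) = \<Sum> D + a" by blast+
qed

text \<open>
  The inverse deletes \<open>m\<close> and recovers the gap as the number of letters in front of \<open>m\<close>.
\<close>

lemma bij_betw_insert_at: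
  assumes fin: "finite A" and m: "m \<notin> A"
  shows "bij_betw (\<lambda>(ys, p). insert_at p m ys)
    (permutations_of_set A \<times> {..card A}) (permutations_of_set (insert m A))"
proof (rule bij_betw_byWitness[where f' =
    "\<lambda>zs. (filter (\<lambda>z. z \<noteq> m) zs, length (takeWhile (\<lambda>z. z \<noteq> m) zs))"])
  have len: "length ys = card A" if "ys \<in> permutations_of_set A" for ys
    using that distinct_card[of ys] by (auto simp: permutations_of_set_def)
  have nm: "m \<notin> set ys" if "ys \<in> permutations_of_set A" for ys
    using that m by (auto simp: permutations_of_set_def)
  show "\<forall>yp\<in>permutations_of_set A \<times> {..card A}.
    (\<lambda>zs. (filter (\<lambda>z. z \<noteq> m) zs, length (takeWhile (\<lambda>z. z \<noteq> m) zs)))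
      ((\<lambda>(ys, p). insert_at p m ys) yp) = yp"
  proof clarsimp
    fix ys p assume ys: "ys \<in> permutations_of_set A" and p: "p \<le> card A"
    have "\<forall>z\<in>set (take p ys). z \<noteq> m" "\<forall>z\<in>set (drop p ys). z \<noteq> m"
      using nm[OF ys] by (auto dest: in_set_takeD in_set_dropD)
    then show "filter (\<lambda>z. z \<noteq> m) (insert_at p m ys) = ys
        \<and> length (takeWhile (\<lambda>z. z \<noteq> m) (insert_at p m ys)) = p"
      using len[OF ys] p by (simp add: insert_at_def filter_True takeWhile_append2)
  qed
  show "\<forall>zs\<in>permutations_of_set (insert m A). (\<lambda>(ys, p). insert_at p m ys)
    (filter (\<lambda>z. z \<noteq> m) zs, length (takeWhile (\<lambda>z. z \<noteq> m) zs)) = zs"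
  proof
    fix zs assume zs: "zs \<in> permutations_of_set (insert m A)"
    then have "m \<in> set zs" "distinct zs" by (auto simp: permutations_of_set_def)
    then obtain u v where uv: "zs = u @ m # v" "m \<notin> set u" "m \<notin> set v"
      by (metis split_list_first distinct.simps(2) distinct_append)
    then have "\<forall>z\<in>set u. z \<noteq> m" "\<forall>z\<in>set v. z \<noteq> m"
      by auto
    then have "filter (\<lambda>z. z \<noteq> m) zs = u @ v" "takeWhile (\<lambda>z. z \<noteq> m) zs = u"
      by (simp_all add: uv filter_True takeWhile_append2)
    then show "(\<lambda>(ys, p). insert_at p m ys)
      (filter (\<lambda>z. z \<noteq> m) zs, length (takeWhile (\<lambda>z. z \<noteq> m) zs)) = zs"
      using uv by (simp add: insert_at_def)
  qed
  show "(\<lambda>(ys, p). insert_at p m ys) ` (permutations_of_set A \<times> {..card A})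
      \<subseteq> permutations_of_set (insert m A)"
  proof clarsimp
    fix ys p assume ys: "ys \<in> permutations_of_set A"
    have "set (take p ys) \<union> set (drop p ys) = A"
      using ys by (metis append_take_drop_id set_append permutations_of_setD(1))
    moreover have "distinct (take p ys)" "distinct (drop p ys)"
        "set (take p ys) \<inter> set (drop p ys) = {}"
      using ys by (simp_all add: permutations_of_setD(2) set_take_disj_set_drop_if_distinct)
    ultimately show "insert_at p m ys \<in> permutations_of_set (insert m A)"
      using m by (intro permutations_of_setI) (auto simp: insert_at_def)
  qed
  show "(\<lambda>zs. (filter (\<lambda>z. z \<noteq> m) zs, length (takeWhile (\<lambda>z. z \<noteq> m) zs)))
      ` permutations_of_set (insert m A) \<subseteq> permutations_of_set A \<times> {..card A}"
  proof clarsimp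
    fix zs assume zs: "zs \<in> permutations_of_set (insert m A)"
    have f: "filter (\<lambda>z. z \<noteq> m) zs \<in> permutations_of_set A"
      using zs m by (auto simp: permutations_of_set_def)
    have "length (takeWhile (\<lambda>z. z \<noteq> m) zs) \<le> length (filter (\<lambda>z. z \<noteq> m) zs)"
      by (induction zs) auto
    then show "filter (\<lambda>z. z \<noteq> m) zs \<in> permutations_of_set A
        \<and> length (takeWhile (\<lambda>z. z \<noteq> m) zs) \<le> card A"
      using f len[OF f] by simp
  qed
qed

text \<open>
  Build the orderings of \<open>A\<close> by inserting \<open>Max A\<close> into those of the remaining letters.  Summing over
  the gap \<open>p\<close> is the same as summing over the gain, by \<open>bij_betw_maj_gain\<close>.
\<close>

lemma sum_des_maj:
  assumes "finite A" "card A = n"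
  shows "(\<Sum>xs\<in>permutations_of_set A. g (card (word_Des xs)) (\<Sum> (word_Des xs)))
       = eulerian_step_sum n g"
  using assms
proof (induction n arbitrary: A g)
  case (Suc n)
  define m B where "m = Max A" and "B = A - {m}"
  have "m \<in> A" using Suc.prems unfolding m_def by (intro Max_in) auto
  then have A: "A = insert m B" and mB: "m \<notin> B" and fin: "finite B" and card: "card B = n"
    using Suc.prems by (auto simp: B_def)
  have lt: "y < m" if "y \<in> B" for y
    using that Max_ge[OF Suc.prems(1), of y] by (auto simp: B_def m_def)
  let ?G = "\<lambda>s k. \<Sum>a\<le>n. g (if a \<le> s then s else Suc s) (k + a)"
  have "(\<Sum>xs\<in>permutations_of_set A. g (card (word_Des xs)) (\<Sum> (word_Des xs)))
    = (\<Sum>(ys, p)\<in>permutations_of_set B \<times> {..n}.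
        g (card (word_Des (insert_at p m ys))) (\<Sum> (word_Des (insert_at p m ys))))"
    unfolding A
    using sum.reindex_bij_betw[OF bij_betw_insert_at[OF fin mB],
        of "\<lambda>xs. g (card (word_Des xs)) (\<Sum> (word_Des xs))"]
    by (simp add: card case_prod_unfold)
  also have "\<dots> = (\<Sum>ys\<in>permutations_of_set B. \<Sum>p\<le>n.
        g (card (word_Des (insert_at p m ys))) (\<Sum> (word_Des (insert_at p m ys))))"
    by (rule sum.cartesian_product[symmetric])
  also have "\<dots> = (\<Sum>ys\<in>permutations_of_set B. ?G (card (word_Des ys)) (\<Sum> (word_Des ys)))"
  proof (rule sum.cong[OF refl])
    fix ys assume ys: "ys \<in> permutations_of_set B"
    let ?D = "word_Des ys"
    let ?f = "\<lambda>a. g (if a \<le> card ?D then card ?D else Suc (card ?D)) (\<Sum> ?D + a)"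
    have len: "length ys = n" and ys_lt: "\<And>y. y \<in> set ys \<Longrightarrow> y < m"
      using ys card lt distinct_card[of ys] by (auto simp: permutations_of_set_def)
    have D: "?D \<subseteq> {1..<n}" by (auto simp: word_Des_def len)
    have "(\<Sum>p\<le>n. g (card (word_Des (insert_at p m ys))) (\<Sum> (word_Des (insert_at p m ys))))
        = (\<Sum>p\<le>n. ?f (maj_gain ?D n p))"
      using des_maj_insert_at[OF ys_lt] by (intro sum.cong[OF refl]) (simp add: len)
    also have "\<dots> = (\<Sum>a\<le>n. ?f a)"
      by (rule sum.reindex_bij_betw[OF bij_betw_maj_gain[OF D]])
    finally show "(\<Sum>p\<le>n. g (card (word_Des (insert_at p m ys))) (\<Sum> (word_Des (insert_at p m ys))))
        = ?G (card ?D) (\<Sum> ?D)" .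
  qed
  also have "\<dots> = eulerian_step_sum (Suc n) g"
    using Suc.IH[OF fin card, of ?G] by simp
  finally show ?case .
qed (simp add: word_Des_def)

section \<open>The statistics of a signed permutation as statistics of its word\<close>

definition word :: "nat \<Rightarrow> (int \<Rightarrow> int) \<Rightarrow> int list" where
  "word n \<sigma> = map (\<lambda>i. \<sigma> (int i + 1)) [0..<n]"

lemma length_word [simp]: "length (word n \<sigma>) = n"
  by (simp add: word_def)

lemma word_Suc: "word (Suc n) \<sigma> = \<sigma> 1 # word n (\<lambda>i. \<sigma> (i + 1))"
  by (simp add: word_def upt_conv_Cons map_Suc_upt[symmetric] ac_simps del: upt_Suc)

lemma set_word: "set (word n \<sigma>) = (\<lambda>i. \<sigma> (int i)) ` {1..n}"
proof -
  have "set (word n \<sigma>) = (\<lambda>i. \<sigma> (int i)) ` Suc ` {0..<n}"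
    by (simp add: word_def image_image ac_simps del: image_Suc_atLeastLessThan)
  also have "Suc ` {0..<n} = {1..n}"
    by (simp add: image_Suc_atLeastLessThan atLeastLessThanSuc_atLeastAtMost)
  finally show ?thesis .
qed

lemma Des_word: "word_Des (word n \<sigma>) = Des n \<sigma>"
  by (auto simp: word_Des_def Des_def word_def algebra_simps)

definition st_witness :: "nat \<Rightarrow> (nat \<Rightarrow> nat) \<Rightarrow> nat \<Rightarrow> (nat \<Rightarrow> nat) \<Rightarrow> bool" where
  "st_witness n w r f \<longleftrightarrow>
     strict_mono_on {1..r} f \<and> f ` {1..r} \<subseteq> {1..n} \<and> (\<forall>j \<in> {1..r}. w (f j) > r - j)"

lemma st_witness_le: "st_witness n w r f \<Longrightarrow> r \<le> n"
  using card_inj_on_le[of f "{1..r}" "{1..n}"]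
  by (auto simp: st_witness_def dest: strict_mono_on_imp_inj_on)

text \<open>
  The condition on \<open>f j\<close> depends only on the distance \<open>r - j\<close> to the end, so the last \<open>r'\<close> indices of
  a witness form a witness.  Hence the attainable values of \<open>r\<close> are closed downwards, and \<open>st\<close> can be
  replaced by comparisons \<open>r \<le> st n w\<close>.
\<close>

lemma st_witness_drop:
  assumes f: "st_witness n w r f" and le: "r' \<le> r"
  shows "st_witness n w r' (\<lambda>j. f (j + (r - r')))"
proof -
  have in_r: "j + (r - r') \<in> {1..r}" if "j \<in> {1..r'}" for j
    using that le by auto
  have "r - (j + (r - r')) = r' - j" if "j \<in> {1..r'}" for j
    using that le by auto
  with f in_r show ?thesis
    unfolding st_witness_def strict_mono_on_def image_subset_iff
    by (metis add_less_mono1)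
qed

lemma le_st_iff: "r \<le> st n w \<longleftrightarrow> (\<exists>f. st_witness n w r f)"
proof -
  define R where "R = insert 0 {r \<in> {1..n}. \<exists>f. st_witness n w r f}"
  have fin: "finite R" and st: "st n w = Max R"
    by (simp_all add: R_def st_def st_witness_def)
  have "st_witness n w 0 f" for f
    by (simp add: st_witness_def strict_mono_on_def)
  then have R: "s \<in> R \<longleftrightarrow> (\<exists>f. st_witness n w s f)" for s
    using st_witness_le[of n w s] by (cases "s = 0") (auto simp: R_def)
  have "Max R \<in> R" using fin by (intro Max_in) (auto simp: R_def)
  then show ?thesis
    unfolding st using R st_witness_drop Max_ge[OF fin] by meson
qed

text \<open>
  A witness of length \<open>r + 1\<close> either avoids the first entry of the code, or starts with it; then that
  entry exceeds \<open>r\<close>, and the rest is a witness of length \<open>r\<close> in the remaining code.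
\<close>

lemma Suc_le_st_Suc_iff:
  "Suc r \<le> st (Suc n) w \<longleftrightarrow>
     Suc r \<le> st n (\<lambda>i. w (Suc i)) \<or> r < w 1 \<and> r \<le> st n (\<lambda>i. w (Suc i))"
    (is "_ \<longleftrightarrow> Suc r \<le> st n ?w \<or> _")
proof
  assume "Suc r \<le> st (Suc n) w"
  then obtain f where "st_witness (Suc n) w (Suc r) f"
    by (auto simp: le_st_iff)
  then have mono: "\<And>i j. 1 \<le> i \<Longrightarrow> i < j \<Longrightarrow> j \<le> Suc r \<Longrightarrow> f i < f j"
    and ran: "\<And>j. 1 \<le> j \<Longrightarrow> j \<le> Suc r \<Longrightarrow> 1 \<le> f j \<and> f j \<le> Suc n"
    and val: "\<And>j. 1 \<le> j \<Longrightarrow> j \<le> Suc r \<Longrightarrow> Suc r - j < w (f j)"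
    by (auto simp: st_witness_def strict_mono_on_def image_subset_iff)
  have gt: "1 < f j" if "f 1 \<noteq> 1 \<or> 1 < j" "1 \<le> j" "j \<le> Suc r" for j
    using that ran[of 1] ran[of j] mono[of 1 j] by (cases "j = 1") auto
  show "Suc r \<le> st n ?w \<or> r < w 1 \<and> r \<le> st n ?w"
  proof (cases "f 1 = 1")
    case True
    have "st_witness n ?w r (\<lambda>j. f (Suc j) - 1)"
      unfolding st_witness_def
    proof (intro conjI ballI subsetI strict_mono_onI)
      fix i j assume "i \<in> {1..r}" "j \<in> {1..r}" "i < j"
      then show "f (Suc i) - 1 < f (Suc j) - 1"
        using mono[of "Suc i" "Suc j"] gt[of "Suc i"] by auto
    next
      fix k assume "k \<in> (\<lambda>j. f (Suc j) - 1) ` {1..r}"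
      then obtain j where "k = f (Suc j) - 1" "j \<in> {1..r}" by blast
      then show "k \<in> {1..n}" using gt[of "Suc j"] ran[of "Suc j"] by auto
    next
      fix j assume "j \<in> {1..r}"
      then show "r - j < ?w (f (Suc j) - 1)" using gt[of "Suc j"] val[of "Suc j"] by auto
    qed
    then have "r \<le> st n ?w" by (auto simp: le_st_iff)
    then show ?thesis using val[of 1] True by simp
  next
    case False
    have "st_witness n ?w (Suc r) (\<lambda>j. f j - 1)"
      unfolding st_witness_def
    proof (intro conjI ballI subsetI strict_mono_onI)
      fix i j assume "i \<in> {1..Suc r}" "j \<in> {1..Suc r}" "i < j"
      then show "f i - 1 < f j - 1"
        using mono[of i j] gt[of i] False by auto
    next
      fix k assume "k \<in> (\<lambda>j. f j - 1) ` {1..Suc r}"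
      then obtain j where "k = f j - 1" "j \<in> {1..Suc r}" by blast
      then show "k \<in> {1..n}" using gt[of j] ran[of j] False by auto
    next
      fix j assume "j \<in> {1..Suc r}"
      then show "Suc r - j < ?w (f j - 1)" using gt[of j] val[of j] False by auto
    qed
    then show ?thesis by (auto simp: le_st_iff)
  qed
next
  assume "Suc r \<le> st n ?w \<or> r < w 1 \<and> r \<le> st n ?w"
  then show "Suc r \<le> st (Suc n) w"
  proof
    assume "Suc r \<le> st n ?w"
    then obtain f where "st_witness n ?w (Suc r) f" by (auto simp: le_st_iff)
    then have "st_witness (Suc n) w (Suc r) (\<lambda>j. Suc (f j))"
      by (fastforce simp: st_witness_def strict_mono_on_def)
    then show ?thesis by (auto simp: le_st_iff)
  next
    assume A: "r < w 1 \<and> r \<le> st n ?w"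
    then obtain f where f: "st_witness n ?w r f" by (auto simp: le_st_iff)
    then have mono: "\<And>i j. 1 \<le> i \<Longrightarrow> i < j \<Longrightarrow> j \<le> r \<Longrightarrow> f i < f j"
      and ran: "\<And>j. 1 \<le> j \<Longrightarrow> j \<le> r \<Longrightarrow> 1 \<le> f j \<and> f j \<le> n"
      and val: "\<And>j. 1 \<le> j \<Longrightarrow> j \<le> r \<Longrightarrow> r - j < w (Suc (f j))"
      by (auto simp: st_witness_def strict_mono_on_def image_subset_iff)
    let ?f = "\<lambda>j. if j = 1 then 1 else Suc (f (j - 1))"
    have "st_witness (Suc n) w (Suc r) ?f"
      unfolding st_witness_def
    proof (intro conjI ballI subsetI strict_mono_onI)
      fix i j assume "i \<in> {1..Suc r}" "j \<in> {1..Suc r}" "i < j"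
      then show "?f i < ?f j"
        using ran[of "j - 1"] mono[of "i - 1" "j - 1"] by (cases i; cases j) auto
    next
      fix k assume "k \<in> ?f ` {1..Suc r}"
      then obtain j where "k = ?f j" "j \<in> {1..Suc r}"
        by blast
      then show "k \<in> {1..Suc n}" using ran[of "j - 1"] by (auto split: if_splits)
    next
      fix j assume "j \<in> {1..Suc r}"
      then show "Suc r - j < w (?f j)"
        using A val[of "j - 1"] by auto
    qed
    then show ?thesis by (auto simp: le_st_iff)
  qed
qed

lemma st_Suc:
  "st (Suc n) w =
     (if w 1 \<le> st n (\<lambda>i. w (Suc i)) then st n (\<lambda>i. w (Suc i)) else Suc (st n (\<lambda>i. w (Suc i))))"
    (is "_ = ?s")
proof -
  have le_iff: "r \<le> st (Suc n) w \<longleftrightarrow> r \<le> ?s" for r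
    using Suc_le_st_Suc_iff[of "r - 1" n w] by (cases r) auto
  show ?thesis
    by (rule order_antisym[OF le_iff[THEN iffD1, OF order_refl] le_iff[THEN iffD2, OF order_refl]])
qed

lemma lehmer_code_shift: "lehmer_code (Suc n) \<sigma> (Suc i) = lehmer_code n (\<lambda>k. \<sigma> (k + 1)) i"
  unfolding lehmer_code_def
  by (rule bij_betw_same_card[symmetric, of Suc], rule bij_betw_byWitness[where f' = "\<lambda>j. j - 1"])
    (auto simp: ac_simps)

lemma lehmer_code_1:
  "lehmer_code (Suc n) \<sigma> 1 = length (filter (\<lambda>y. y < \<sigma> 1) (word n (\<lambda>k. \<sigma> (k + 1))))"
  unfolding lehmer_code_def length_filter_conv_card
  by (rule bij_betw_same_card[of "\<lambda>j. j - 2"], rule bij_betw_byWitness[where f' = "\<lambda>i. i + 2"])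
    (auto simp: word_def ac_simps)

lemma stc_word: "stc n \<sigma> = word_stc (word n \<sigma>)"
proof (induction n arbitrary: \<sigma>)
  case 0
  show ?case by (simp add: stc_def st_def word_def)
next
  case (Suc n)
  then show ?case
    by (simp add: stc_def st_Suc lehmer_code_shift lehmer_code_1 word_Suc del: One_nat_def)
qed

lemma inversion_number_eq_sum_lehmer_code: "inversion_number n \<sigma> = (\<Sum>i = 1..n. lehmer_code n \<sigma> i)"
proof -
  have "{(i, j). (i, j) \<in> {1..n} \<times> {1..n} \<and> i < j \<and> \<sigma> (int i) > \<sigma> (int j)}
      = (SIGMA i:{1..n}. {j. i < j \<and> j \<le> n \<and> \<sigma> (int i) > \<sigma> (int j)})"
    by auto
  then show ?thesis
    unfolding inversion_number_def lehmer_code_def by (simp only:) (rule card_SigmaI, auto)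
qed

lemma inversion_number_word: "inversion_number n \<sigma> = word_inv (word n \<sigma>)"
proof (induction n arbitrary: \<sigma>)
  case 0
  show ?case by (simp add: inversion_number_def word_def)
next
  case (Suc n)
  have "inversion_number (Suc n) \<sigma> =
      lehmer_code (Suc n) \<sigma> 1 + (\<Sum>i = 1..n. lehmer_code (Suc n) \<sigma> (Suc i))"
    unfolding inversion_number_eq_sum_lehmer_code
    by (simp only: sum.atLeast1_atMost_eq sum.lessThan_Suc_shift One_nat_def)
  also have "(\<Sum>i = 1..n. lehmer_code (Suc n) \<sigma> (Suc i)) = inversion_number n (\<lambda>k. \<sigma> (k + 1))"
    by (simp only: lehmer_code_shift inversion_number_eq_sum_lehmer_code)
  finally show ?case
    by (simp add: lehmer_code_1 word_Suc Suc.IH del: One_nat_def)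
qed

section \<open>Splitting the hyperoctahedral group by the set of letters\<close>

text \<open>
  If \<open>|\<sigma>\<^sub>i| = |\<sigma>\<^sub>j|\<close>, then \<open>\<sigma>\<^sub>i\<close> is \<open>\<sigma>(j)\<close> or \<open>\<sigma>(-j)\<close>, and injectivity gives \<open>i = j\<close> because \<open>i\<close> and \<open>j\<close>
  are positive.
\<close>

lemma bij_betw_abs_hyperoctahedral:
  assumes "\<sigma> \<in> hyperoctahedral n"
  shows "bij_betw (\<lambda>i. \<bar>\<sigma> (int i)\<bar>) {1..n} {1..int n}"
proof -
  have perm: "\<sigma> permutes ({- int n..int n} - {0})"
    and neg: "\<And>i. i \<in> {- int n..int n} - {0} \<Longrightarrow> \<sigma> (- i) = - \<sigma> i"
    using assms by (auto simp: hyperoctahedral_def)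
  have inj: "inj_on (\<lambda>i. \<bar>\<sigma> (int i)\<bar>) {1..n}"
  proof (rule inj_onI)
    fix i j assume ij: "i \<in> {1..n}" "j \<in> {1..n}" "\<bar>\<sigma> (int i)\<bar> = \<bar>\<sigma> (int j)\<bar>"
    then have "\<sigma> (int i) = \<sigma> (int j) \<or> \<sigma> (int i) = \<sigma> (- int j)"
      using neg[of "int j"] by (auto simp: abs_eq_iff)
    then have "int i = int j \<or> int i = - int j"
      by (simp add: inj_eq[OF permutes_inj[OF perm]])
    then show "i = j" using ij by auto
  qed
  have "\<bar>\<sigma> (int i)\<bar> \<in> {1..int n}" if "i \<in> {1..n}" for i
    using permutes_in_image[OF perm, of "int i"] that by auto
  with inj have "(\<lambda>i. \<bar>\<sigma> (int i)\<bar>) ` {1..n} = {1..int n}"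
    by (intro card_subset_eq) (auto simp: card_image)
  with inj show ?thesis by (simp add: bij_betw_def)
qed

lemma inj_on_hyperoctahedral:
  assumes "\<sigma> \<in> hyperoctahedral n"
  shows "inj_on (\<lambda>i. \<sigma> (int i)) {1..n}"
  using bij_betw_imp_inj_on[OF bij_betw_abs_hyperoctahedral[OF assms]]
  unfolding inj_on_def by metis

definition signed_words :: "nat \<Rightarrow> int list set" where
  "signed_words n = {xs. length xs = n \<and> abs ` set xs = {1..int n}}"

lemma signed_words_distinct:
  assumes "xs \<in> signed_words n"
  shows "distinct (map abs xs)" "card (set xs) = n"
proof -
  have eq: "set (map abs xs) = {1..int n}" and len: "length xs = n"
    using assms by (auto simp: signed_words_def)
  have "card (set (map abs xs)) = length (map abs xs)"
    unfolding eq by (simp add: len)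
  then show "distinct (map abs xs)" by (rule card_distinct)
  then have "distinct xs" by (simp add: distinct_map)
  then show "card (set xs) = n" using len by (simp add: distinct_card)
qed

lemma bij_betw_word: "bij_betw (word n) (hyperoctahedral n) (signed_words n)"
proof -
  let ?S = "{- int n..int n} - {0}"
  have "inj_on (word n) (hyperoctahedral n)"
  proof (rule inj_onI)
    fix \<sigma> \<tau> assume \<sigma>: "\<sigma> \<in> hyperoctahedral n" and \<tau>: "\<tau> \<in> hyperoctahedral n"
      and eq: "word n \<sigma> = word n \<tau>"
    have pos: "\<sigma> (int i) = \<tau> (int i)" if "i \<in> {1..n}" for i
      using arg_cong[OF eq, of "\<lambda>xs. xs ! (i - 1)"] that by (auto simp: word_def)
    show "\<sigma> = \<tau>"
    proof (rule ext)
      fix k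
      consider "k \<notin> ?S" | i where "i \<in> {1..n}" "k = int i" | i where "i \<in> {1..n}" "k = - int i"
      proof (cases "k \<in> ?S")
        case True
        then show ?thesis using that(2)[of "nat k"] that(3)[of "nat (- k)"] by (cases "k > 0") auto
      qed
      then show "\<sigma> k = \<tau> k"
      proof cases
        case 1
        then show ?thesis using \<sigma> \<tau> by (simp add: hyperoctahedral_def permutes_def)
      next
        case (3 i)
        then show ?thesis using \<sigma> \<tau> pos[of i] by (auto simp: hyperoctahedral_def)
      qed (use pos in auto)
    qed
  qed
  moreover have "word n \<sigma> \<in> signed_words n" if "\<sigma> \<in> hyperoctahedral n" for \<sigma>
    using bij_betw_imp_surj_on[OF bij_betw_abs_hyperoctahedral[OF that]]
    by (simp add: signed_words_def set_word image_image)
  moreover have "xs \<in> word n ` hyperoctahedral n" if xs: "xs \<in> signed_words n" for xs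
  proof -
    (* The only odd extension of the word that is the identity elsewhere. *)
    define \<sigma> where "\<sigma> k = (if k \<in> ?S then sgn k * xs ! (nat \<bar>k\<bar> - 1) else k)" for k
    have len: "length xs = n" and im: "abs ` set xs = {1..int n}"
      using xs by (auto simp: signed_words_def)
    have letter: "\<bar>xs ! i\<bar> \<in> {1..int n}" if "i < n" for i
      using that im len by (metis imageI nth_mem)
    have index: "nat \<bar>k\<bar> - 1 < n" if "k \<in> ?S" for k
      using that by auto
    have "inj_on \<sigma> ?S"
    proof (rule inj_onI)
      fix k l assume k: "k \<in> ?S" and l: "l \<in> ?S" and eq: "\<sigma> k = \<sigma> l"
      have e: "sgn k * xs ! (nat \<bar>k\<bar> - 1) = sgn l * xs ! (nat \<bar>l\<bar> - 1)"
        using eq k l unfolding \<sigma>_def by simp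
      have "\<bar>xs ! (nat \<bar>k\<bar> - 1)\<bar> = \<bar>xs ! (nat \<bar>l\<bar> - 1)\<bar>"
        using arg_cong[OF e, of abs] k l by (simp add: abs_mult abs_sgn_eq)
      then have "nat \<bar>k\<bar> - 1 = nat \<bar>l\<bar> - 1"
        using nth_eq_iff_index_eq[OF signed_words_distinct(1)[OF xs]] index[OF k] index[OF l] len
        by simp
      then have kl: "\<bar>k\<bar> = \<bar>l\<bar>" using k l by auto
      then have "sgn k = sgn l"
        using e letter[OF index[OF l]] by auto
      then show "k = l" using kl by (metis abs_mult_sgn mult.commute)
    qed
    moreover have "\<sigma> k \<in> ?S" if k: "k \<in> ?S" for k
    proof -
      have "\<bar>\<sigma> k\<bar> = \<bar>xs ! (nat \<bar>k\<bar> - 1)\<bar>"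
        using k unfolding \<sigma>_def by (simp add: abs_mult abs_sgn_eq)
      then have "1 \<le> \<bar>\<sigma> k\<bar>" "\<bar>\<sigma> k\<bar> \<le> int n"
        using letter[OF index[OF k]] by (simp_all only: atLeastAtMost_iff)
      then show ?thesis by (auto simp: abs_le_iff)
    qed
    then have "\<sigma> ` ?S \<subseteq> ?S" by (rule image_subsetI)
    moreover have "finite ?S" by simp
    ultimately have "bij_betw \<sigma> ?S ?S"
      unfolding bij_betw_def by (intro conjI endo_inj_surj)
    then have "\<sigma> permutes ?S"
      by (rule bij_imp_permutes) (auto simp: \<sigma>_def)
    then have "\<sigma> \<in> hyperoctahedral n"
      by (auto simp: hyperoctahedral_def \<sigma>_def sgn_minus)
    moreover have "word n \<sigma> = xs"
    proof (rule nth_equalityI)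
      fix i assume "i < length (word n \<sigma>)"
      then show "word n \<sigma> ! i = xs ! i" by (auto simp: word_def \<sigma>_def nat_add_distrib)
    qed (simp add: len)
    ultimately show ?thesis by blast
  qed
  ultimately show ?thesis by (auto simp: bij_betw_def)
qed

definition letter_neg :: "int set \<Rightarrow> nat" where
  "letter_neg A = card {a \<in> A. a < 0}"

definition letter_weight :: "int set \<Rightarrow> nat" where
  "letter_weight A = (\<Sum>a | a \<in> A \<and> a < 0. nat (- a))"

text \<open>
  The words of signed permutations with a given letter set are all the orderings of that set, since
  the only restriction on a word concerns its letters.
\<close>

lemma sum_hyperoctahedral_by_letters:
  "(\<Sum>\<sigma>\<in>hyperoctahedral n. F (word n \<sigma>)) =
     (\<Sum>A\<in>set ` signed_words n. \<Sum>xs\<in>permutations_of_set A. F xs)"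
proof -
  have fin: "finite (signed_words n)"
    using bij_betw_finite[OF bij_betw_word] finite_hyperoctahedral by blast
  have fiber: "{xs \<in> signed_words n. set xs = A} = permutations_of_set A"
    if A: "A \<in> set ` signed_words n" for A
  proof -
    obtain ys where ys: "ys \<in> signed_words n" "A = set ys" using A by blast
    have "xs \<in> signed_words n \<and> set xs = A \<longleftrightarrow> set xs = A \<and> distinct xs" for xs
      using ys signed_words_distinct(1)[of xs n] signed_words_distinct(2)[OF ys(1)] distinct_card[of xs]
      by (auto simp: distinct_map signed_words_def)
    then show ?thesis by (auto simp: permutations_of_set_def)
  qed
  have "(\<Sum>\<sigma>\<in>hyperoctahedral n. F (word n \<sigma>)) = sum F (signed_words n)"
    by (rule sum.reindex_bij_betw[OF bij_betw_word])
  also have "\<dots> = (\<Sum>A\<in>set ` signed_words n. sum F {xs \<in> signed_words n. set xs = A})"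
    by (rule sum.group[symmetric]) (use fin in auto)
  also have "\<dots> = (\<Sum>A\<in>set ` signed_words n. sum F (permutations_of_set A))"
    by (rule sum.cong[OF refl]) (simp only: fiber)
  finally show ?thesis .
qed

lemma
  assumes "\<sigma> \<in> hyperoctahedral n"
  shows neg_word: "neg n \<sigma> = letter_neg (set (word n \<sigma>))"
    and sum_Neg_word: "(\<Sum>i\<in>Neg n \<sigma>. nat (- \<sigma> (int i))) = letter_weight (set (word n \<sigma>))"
proof -
  have eq: "{a \<in> set (word n \<sigma>). a < 0} = (\<lambda>i. \<sigma> (int i)) ` Neg n \<sigma>"
    by (auto simp: set_word Neg_def)
  have inj: "inj_on (\<lambda>i. \<sigma> (int i)) (Neg n \<sigma>)"
    using inj_on_hyperoctahedral[OF assms] by (rule inj_on_subset) (auto simp: Neg_def)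
  show "neg n \<sigma> = letter_neg (set (word n \<sigma>))"
    using inj by (simp add: neg_def letter_neg_def eq card_image)
  show "(\<Sum>i\<in>Neg n \<sigma>. nat (- \<sigma> (int i))) = letter_weight (set (word n \<sigma>))"
    using inj by (simp add: letter_weight_def eq sum.reindex)
qed

lemma nmaj_word:
  assumes "\<sigma> \<in> hyperoctahedral n"
  shows "nmaj n \<sigma> = \<Sum> (word_Des (word n \<sigma>)) + letter_weight (set (word n \<sigma>))"
proof -
  have "int (\<Sum>i\<in>Neg n \<sigma>. nat (- \<sigma> (int i))) = - (\<Sum>i\<in>Neg n \<sigma>. \<sigma> (int i))"
    by (auto simp: sum_negf[symmetric] Neg_def intro!: sum.cong)
  then have "int (nmaj n \<sigma>) = int (maj n \<sigma> + letter_weight (set (word n \<sigma>)))"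
    by (simp add: int_nmaj sum_Neg_word[OF assms, symmetric] del: of_nat_sum)
  then have "nmaj n \<sigma> = maj n \<sigma> + letter_weight (set (word n \<sigma>))"
    by (simp only: of_nat_eq_iff)
  then show ?thesis by (simp add: maj_def Des_word)
qed

text \<open>
  In a pair with \<open>\<sigma>\<^sub>i + \<sigma>\<^sub>j < 0\<close> the letter of larger absolute value is negative.  Conversely, a
  negative letter \<open>\<sigma>\<^sub>i\<close> forms such a pair with each of the \<open>|\<sigma>\<^sub>i| - 1\<close> letters of smaller absolute
  value.  Together with its contribution to \<open>neg\<close> it accounts for \<open>|\<sigma>\<^sub>i|\<close>.
\<close>

lemma neg_add_nsp:
  assumes "\<sigma> \<in> hyperoctahedral n"
  shows "neg n \<sigma> + nsp n \<sigma> = (\<Sum>i\<in>Neg n \<sigma>. nat (- \<sigma> (int i)))"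
proof -
  let ?r = "\<lambda>i. \<bar>\<sigma> (int i)\<bar>"
  let ?below = "\<lambda>i. {j \<in> {1..n}. ?r j < ?r i}"
  let ?P = "{(i, j). (i, j) \<in> {1..n} \<times> {1..n} \<and> i < j \<and> \<sigma> (int i) + \<sigma> (int j) < 0}"
  let ?Q = "SIGMA i:Neg n \<sigma>. ?below i"
  have bij: "bij_betw ?r {1..n} {1..int n}"
    by (rule bij_betw_abs_hyperoctahedral[OF assms])
  have neq: "?r i \<noteq> ?r j" if "i \<in> {1..n}" "j \<in> {1..n}" "i \<noteq> j" for i j
    using inj_onD[OF bij_betw_imp_inj_on[OF bij] _ that(1,2)] that(3) by blast
  have below: "card (?below i) = nat (?r i) - 1" if i: "i \<in> {1..n}" for i
  proof -
    have img: "?r ` ?below i = {1..<?r i}"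
    proof
      show "?r ` ?below i \<subseteq> {1..<?r i}"
        using bij_betw_apply[OF bij] by auto
      show "{1..<?r i} \<subseteq> ?r ` ?below i"
      proof
        fix v assume v: "v \<in> {1..<?r i}"
        then have "v \<in> {1..int n}" using bij_betw_apply[OF bij i] by auto
        then obtain j where "j \<in> {1..n}" "v = ?r j"
          using bij_betw_imp_surj_on[OF bij] by blast
        then show "v \<in> ?r ` ?below i" using v by auto
      qed
    qed
    have "inj_on ?r (?below i)"
      using bij_betw_imp_inj_on[OF bij] by (rule inj_on_subset) auto
    then have "card (?below i) = card (?r ` ?below i)"
      by (rule card_image[symmetric])
    also have "\<dots> = card {1..<?r i}"
      by (simp only: img)
    finally show ?thesis by simp
  qed
  (* Put the position of the dominating letter first; sorting the two positions undoes this. *)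
  have "bij_betw (\<lambda>(i, j). if ?r j < ?r i then (i, j) else (j, i)) ?P ?Q"
  proof (rule bij_betw_byWitness[where f' = "\<lambda>(i, j). if i < j then (i, j) else (j, i)"])
    show "(\<lambda>(i, j). if ?r j < ?r i then (i, j) else (j, i)) ` ?P \<subseteq> ?Q"
    proof (rule image_subsetI)
      fix y assume y: "y \<in> ?P"
      obtain i j where y_eq: "y = (i, j)" by (cases y)
      have ij: "i \<in> {1..n}" "j \<in> {1..n}" "i < j" "\<sigma> (int i) + \<sigma> (int j) < 0"
        using y by (simp_all add: y_eq)
      show "(\<lambda>(i, j). if ?r j < ?r i then (i, j) else (j, i)) y \<in> ?Q"
      proof (cases "?r j < ?r i")
        case True
        then have "\<sigma> (int i) < 0" using ij(4) by linarith
        then show ?thesis using True ij by (simp add: y_eq Neg_def)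
      next
        case False
        then have "?r i < ?r j" using neq[of i j] ij by linarith
        moreover from this have "\<sigma> (int j) < 0" using ij(4) by linarith
        ultimately show ?thesis using ij by (simp add: y_eq Neg_def)
      qed
    qed
    show "(\<lambda>(i, j). if i < j then (i, j) else (j, i)) ` ?Q \<subseteq> ?P"
    proof (rule image_subsetI)
      fix y assume y: "y \<in> ?Q"
      obtain i j where y_eq: "y = (i, j)" by (cases y)
      have ij: "i \<in> {1..n}" "\<sigma> (int i) < 0" "j \<in> {1..n}" "?r j < ?r i"
        using y by (simp_all only: y_eq Neg_def mem_Sigma_iff mem_Collect_eq)
      then have "\<sigma> (int i) + \<sigma> (int j) < 0" "i \<noteq> j" by auto
      then show "(\<lambda>(i, j). if i < j then (i, j) else (j, i)) y \<in> ?P"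
        using ij by (auto simp: y_eq)
    qed
  qed (auto split: if_splits)
  then have "nsp n \<sigma> = card ?Q"
    unfolding nsp_def by (rule bij_betw_same_card)
  also have "\<dots> = (\<Sum>i\<in>Neg n \<sigma>. card (?below i))"
    by (rule card_SigmaI) (auto simp: Neg_def)
  finally have "neg n \<sigma> + nsp n \<sigma> = (\<Sum>i\<in>Neg n \<sigma>. Suc (card (?below i)))"
    by (simp add: neg_def sum_Suc)
  also have "\<dots> = (\<Sum>i\<in>Neg n \<sigma>. nat (- \<sigma> (int i)))"
  proof (rule sum.cong[OF refl])
    fix i assume "i \<in> Neg n \<sigma>"
    then have i: "i \<in> {1..n}" "\<sigma> (int i) < 0" by (auto simp: Neg_def)
    then have "?r i = - \<sigma> (int i)" by simp
    then show "Suc (card (?below i)) = nat (- \<sigma> (int i))"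
      unfolding below[OF i(1)] using i(2) by simp
  qed
  finally show ?thesis .
qed

lemma coxeter_length_word:
  assumes "\<sigma> \<in> hyperoctahedral n"
  shows "coxeter_length n \<sigma> = word_inv (word n \<sigma>) + letter_weight (set (word n \<sigma>))"
  using neg_add_nsp[OF assms] sum_Neg_word[OF assms]
  by (simp add: coxeter_length_def inversion_number_word)

section \<open>Equidistribution on the hyperoctahedral group\<close>

theorem theorem3p3:
  fixes n :: nat and x q :: "'a :: comm_semiring_1"
  shows "(\<Sum>\<sigma> \<in> hyperoctahedral n. x ^ nstc n \<sigma> * q ^ coxeter_length n \<sigma>) =
         (\<Sum>\<sigma> \<in> hyperoctahedral n. x ^ ndes n \<sigma> * q ^ nmaj n \<sigma>)"
proof -
  let ?g = "\<lambda>A s k. x ^ (s + letter_neg A) * q ^ (k + letter_weight A)"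
  have "(\<Sum>\<sigma> \<in> hyperoctahedral n. x ^ nstc n \<sigma> * q ^ coxeter_length n \<sigma>)
      = (\<Sum>\<sigma> \<in> hyperoctahedral n.
          (\<lambda>xs. ?g (set xs) (word_stc xs) (word_inv xs)) (word n \<sigma>))"
    by (rule sum.cong[OF refl]) (simp add: nstc_def stc_word neg_word coxeter_length_word)
  also have "\<dots> = (\<Sum>A\<in>set ` signed_words n. \<Sum>xs\<in>permutations_of_set A.
          ?g (set xs) (word_stc xs) (word_inv xs))"
    by (rule sum_hyperoctahedral_by_letters)
  also have "\<dots> = (\<Sum>A\<in>set ` signed_words n. \<Sum>xs\<in>permutations_of_set A.
          ?g (set xs) (card (word_Des xs)) (\<Sum> (word_Des xs)))"
  proof (rule sum.cong[OF refl])
    fix A assume "A \<in> set ` signed_words n"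
    then have A: "finite A" "card A = n" using signed_words_distinct(2) by auto
    have "(\<Sum>xs\<in>permutations_of_set A. ?g (set xs) (word_stc xs) (word_inv xs))
        = (\<Sum>xs\<in>permutations_of_set A. ?g A (word_stc xs) (word_inv xs))"
      by (rule sum.cong[OF refl]) (simp add: permutations_of_setD)
    also have "\<dots> = (\<Sum>xs\<in>permutations_of_set A. ?g A (card (word_Des xs)) (\<Sum> (word_Des xs)))"
      using sum_stc_inv[OF A, of "?g A"] sum_des_maj[OF A, of "?g A"] by simp
    also have "\<dots> = (\<Sum>xs\<in>permutations_of_set A.
          ?g (set xs) (card (word_Des xs)) (\<Sum> (word_Des xs)))"
      by (rule sum.cong[OF refl]) (simp add: permutations_of_setD)
    finally show "(\<Sum>xs\<in>permutations_of_set A. ?g (set xs) (word_stc xs) (word_inv xs)) = \<dots>" .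
  qed
  also have "\<dots> = (\<Sum>\<sigma> \<in> hyperoctahedral n.
          (\<lambda>xs. ?g (set xs) (card (word_Des xs)) (\<Sum> (word_Des xs))) (word n \<sigma>))"
    by (rule sum_hyperoctahedral_by_letters[symmetric])
  also have "\<dots> = (\<Sum>\<sigma> \<in> hyperoctahedral n. x ^ ndes n \<sigma> * q ^ nmaj n \<sigma>)"
    by (rule sum.cong[OF refl]) (simp add: ndes_def des_def Des_word neg_word nmaj_word)
  finally show ?thesis .
qed

end
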